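(* Let $a>0$ be an integer and $s\in\{0,1\}$, with $(a,s)\neq(1,1)$ and $(a,s)\neq(2,1)$. Let $S_{a,s}$ be the set of finite sequences of positive integers with alternant $a$ and length parity $s$, and let $Z_{a,s}$ be the set of Zagier-reduced binary quadratic forms of discriminant $a^2+(-1)^s\cdot 4$. Then: (1) for every $\vec q\in S_{a,s}$, the form $\phi_{a,s}(\vec q)$ lies in $Z_{a,s}$; for every $f\in Z_{a,s}$, the sequence $\psi_{a,s}(f)$ lies in $S_{a,s}$; and $\psi_{a,s}\circ\phi_{a,s}$ is the identity on $S_{a,s}$ and $\phi_{a,s}\circ\psi_{a,s}$ is the identity on $Z_{a,s}$, so that $\phi_{a,s}$ and $\psi_{a,s}$ are mutually inverse bijections; (2) Zagier reduction corresponds to kneading under these bijections: if $f\in Z_{a,s}$ and $f'$ is the form obtained from $f$ by one Zagier reduction step, then $f'\in Z_{a,s}$ and $\psi_{a,s}(f')$ is the sequence obtained by kneading $\psi_{a,s}(f)$.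
   Context: A (binary quadratic) form is $Ax^2+Bxy+Cy^2$ with $A,B,C\in\mathbb Z$; its discriminant is $B^2-4AC$. A matrix $\begin{pmatrix}\alpha&\beta\\ \gamma&\delta\end{pmatrix}\in SL_2(\mathbb Z)$ acts on a form $f(x,y)$ by sending it to $f(\alpha x+\beta y,\gamma x+\delta y)$. A form is Zagier-reduced if $A>0$, $C>0$ and $B>A+C$. A Zagier reduction step on a form $f=Ax^2+Bxy+Cy^2$ of positive nonsquare discriminant $D$ consists of taking the unique integer $n$ with $n-1<\frac{B+\sqrt D}{2A}<n$ and acting on $f$ by $\begin{pmatrix} n&1\\-1&0\end{pmatrix}$. Continuants: $[\,]=1$ (empty sequence), $[q_1]=q_1$, and $[q_1,\dots,q_l]=q_1[q_2,\dots,q_l]+[q_3,\dots,q_l]$; $[q_1,\dots,q_l]$ is the numerator of the continued fraction $q_1+\cfrac{1}{q_2+\cfrac{1}{\ddots+\cfrac1{q_l}}}$ in lowest terms. The alternant of a sequence $(q_1,\dots,q_l)$ of positive integers is $[q_1,\dots,q_l]-[q_2,\dots,q_{l-1}]$ if $l\ge 3$, is $q_1$ if $l=1$, and is $q_1q_2$ if $l=2$. The length parity of a finite sequence is $0$ if its length is even and $1$ if odd. The map $\psi_{a,s}:Z_{a,s}\to S_{a,s}$: for $f=Ax^2+Bxy+Cy^2$, put $z=(a+B)/2$ and let $\psi_{a,s}(f)$ be the sequence of partial quotients of the finite simple continued fraction expansion of $z/A$ (with positive integer quotients) chosen among the two possible expansions so that its length has parity $s$. The map $\phi_{a,s}$: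 for $(q_1,\dots,q_l)$, $\phi_{a,s}((q_1,\dots,q_l))=[q_2,\dots,q_l]x^2+([q_1,\dots,q_l]+[q_2,\dots,q_{l-1}])xy+[q_1,\dots,q_{l-1}]y^2$, interpreted as $x^2+q_1xy+y^2$ when $l=1$. Pinching the left end of a finite sequence of positive integers: $(x,y,z,\dots)\mapsto(1,x-1,y,z,\dots)$ if $x\ge2$, and $\mapsto(y+1,z,\dots)$ if $x=1$; the sequence $(1)$ and the empty sequence are left unchanged by pinching. Pinching the right end is defined symmetrically: $(\dots,z,y,x)\mapsto(\dots,z,y,x-1,1)$ if $x\ge 2$ and $\mapsto(\dots,z,y+1)$ if $x=1$. Kneading a sequence: remove its leftmost entry, pinch both ends of what remains (the order does not matter), and then append the removed entry on the right end. (So sequences of length 1 are fixed, and $(a,b)\mapsto(1,b-2,1,a)$ if $b\ge3$, $(a,b)\mapsto(b,a)$ if $b\in\{1,2\}$.) *)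

theory Defs
  imports Complex_Main
begin

text \<open>\<open>BQF A B C\<close> is the form $Ax^2+Bxy+Cy^2$.\<close>

datatype bqf = BQF (coefA: int) (coefB: int) (coefC: int)

definition bqf_eval :: "bqf \<Rightarrow> int \<Rightarrow> int \<Rightarrow> int" where
  "bqf_eval f x y = coefA f * x^2 + coefB f * x * y + coefC f * y^2"

definition bqf_discr :: "bqf \<Rightarrow> int" where
  "bqf_discr f = (coefB f)^2 - 4 * coefA f * coefC f"

text \<open>The action of the matrix with rows \<open>(\<alpha>, \<beta>)\<close> and \<open>(\<gamma>, \<delta>)\<close>;
  the coefficients are justified by \<open>bqf_eval_act\<close> below.\<close>

definition bqf_act :: "int \<Rightarrow> int \<Rightarrow> int \<Rightarrow> int \<Rightarrow> bqf \<Rightarrow> bqf" where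
  "bqf_act \<alpha> \<beta> \<gamma> \<delta> f =
     BQF (coefA f * \<alpha>^2 + coefB f * \<alpha> * \<gamma> + coefC f * \<gamma>^2)
         (2 * coefA f * \<alpha> * \<beta> + coefB f * (\<alpha> * \<delta> + \<beta> * \<gamma>) + 2 * coefC f * \<gamma> * \<delta>)
         (coefA f * \<beta>^2 + coefB f * \<beta> * \<delta> + coefC f * \<delta>^2)"

lemma bqf_eval_act:
  "bqf_eval (bqf_act \<alpha> \<beta> \<gamma> \<delta> f) x y = bqf_eval f (\<alpha> * x + \<beta> * y) (\<gamma> * x + \<delta> * y)"
  by (simp add: bqf_eval_def bqf_act_def algebra_simps power2_eq_square)

definition zagier_reduced :: "bqf \<Rightarrow> bool" where
  "zagier_reduced f \<longleftrightarrow> coefA f > 0 \<and> coefC f > 0 \<and> coefB f > coefA f + coefC f"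

text \<open>Only meaningful for positive nonsquare discriminant; see \<open>zagier_step_ex1\<close>.\<close>

definition zagier_step :: "bqf \<Rightarrow> bqf" where
  "zagier_step f =
     (let \<theta> = (of_int (coefB f) + sqrt (of_int (bqf_discr f))) / (2 * of_int (coefA f)) :: real;
          n = (THE n::int. of_int n - 1 < \<theta> \<and> \<theta> < of_int n)
      in bqf_act n 1 (-1) 0 f)"

lemma zagier_step_ex1:
  assumes "bqf_discr f > 0" and "\<nexists>k. bqf_discr f = k^2"
  shows "\<exists>!n::int. of_int n - 1 < (of_int (coefB f) + sqrt (of_int (bqf_discr f))) / (2 * of_int (coefA f)) \<and>
           (of_int (coefB f) + sqrt (of_int (bqf_discr f))) / (2 * of_int (coefA f)) < (of_int n :: real)"
proof -
  define \<theta> :: real where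
    "\<theta> = (of_int (coefB f) + sqrt (of_int (bqf_discr f))) / (2 * of_int (coefA f))"
  have A: "coefA f \<noteq> 0" using assms(2) by (auto simp: bqf_discr_def)
  have nonint: "\<theta> \<noteq> of_int k" for k
  proof
    assume "\<theta> = of_int k"
    hence "sqrt (of_int (bqf_discr f)) = of_int (2 * coefA f * k - coefB f)"
      using A by (simp add: \<theta>_def field_simps)
    hence "of_int (bqf_discr f) = (of_int (2 * coefA f * k - coefB f) :: real)^2"
      using assms(1) by (metis less_eq_real_def of_int_0_less_iff real_sqrt_pow2)
    hence "bqf_discr f = (2 * coefA f * k - coefB f)^2"
      by (metis of_int_eq_iff of_int_power)
    thus False using assms(2) by blast
  qed
  have "\<exists>!n::int. of_int n - 1 < \<theta> \<and> \<theta> < of_int n"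
  proof (rule ex1I[of _ "\<lceil>\<theta>\<rceil>"])
    show "of_int \<lceil>\<theta>\<rceil> - 1 < \<theta> \<and> \<theta> < of_int \<lceil>\<theta>\<rceil>"
      using nonint[of "\<lceil>\<theta>\<rceil>"] le_of_int_ceiling[of \<theta>] ceiling_correct[of \<theta>] by linarith
  next
    fix n :: int assume "of_int n - 1 < \<theta> \<and> \<theta> < of_int n"
    thus "n = \<lceil>\<theta>\<rceil>" by linarith
  qed
  thus ?thesis unfolding \<theta>_def .
qed

fun continuant :: "int list \<Rightarrow> int" where
  "continuant [] = 1"
| "continuant [q] = q"
| "continuant (q # r # qs) = q * continuant (r # qs) + continuant qs"

text \<open>The alternant of the empty sequence is irrelevant: all sequences below are nonempty.\<close>

fun alternant :: "int list \<Rightarrow> int" where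
  "alternant [] = 0"
| "alternant [q] = q"
| "alternant [q, r] = q * r"
| "alternant (q # r # t # qs) =
     continuant (q # r # t # qs) - continuant (butlast (r # t # qs))"

text \<open>The value of $q_1 + 1/(q_2 + 1/(\cdots + 1/q_l))$; the empty sequence is a dummy case.\<close>

fun cf_value :: "int list \<Rightarrow> rat" where
  "cf_value [] = 0"
| "cf_value [q] = of_int q"
| "cf_value (q # r # qs) = of_int q + 1 / cf_value (r # qs)"

definition cf_expansion :: "rat \<Rightarrow> nat \<Rightarrow> int list" where
  "cf_expansion x s = (THE q. q \<noteq> [] \<and> (\<forall>n\<in>set q. 0 < n) \<and> cf_value q = x \<and> length q mod 2 = s)"

lemma cf_value_ge_1:
  assumes "q \<noteq> []" "\<forall>n\<in>set q. 0 < n"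
  shows "cf_value q \<ge> 1 \<and> (cf_value q = 1 \<longleftrightarrow> q = [1])"
  using assms
proof (induction q rule: cf_value.induct)
  case (3 q r qs)
  have "cf_value (r # qs) \<ge> 1" using 3 by simp
  hence "1 / cf_value (r # qs) > 0" by simp
  moreover have "(of_int q :: rat) \<ge> 1" using 3(3) by simp
  ultimately have "cf_value (q # r # qs) > 1"
    unfolding cf_value.simps by linarith
  thus ?case by simp
qed auto

lemma cf_value_inj:
  assumes "p \<noteq> []" "q \<noteq> []" "\<forall>n\<in>set p. 0 < n" "\<forall>n\<in>set q. 0 < n"
    "cf_value p = cf_value q" "length p mod 2 = length q mod 2"
  shows "p = q"
  using assms
proof (induction p arbitrary: q rule: cf_value.induct)
  case 1
  thus ?case by simp
next
  case (2 a)
  show ?case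
  proof (cases q rule: cf_value.cases)
    case (3 b r qs)
    have ge: "cf_value (r # qs) \<ge> 1" "cf_value (r # qs) = 1 \<longleftrightarrow> r # qs = [1]"
      using cf_value_ge_1[of "r # qs"] 2(4) 3 by auto
    have eq: "(of_int a :: rat) = of_int b + 1 / cf_value (r # qs)" using 2(5) 3 by simp
    hence "1 / cf_value (r # qs) = (of_int (a - b) :: rat)" by simp
    moreover have "1 / cf_value (r # qs) > 0" "1 / cf_value (r # qs) \<le> 1" using ge(1) by auto
    ultimately have "0 < a - b" "a - b \<le> 1"
      by (metis of_int_0_less_iff, metis of_int_le_1_iff)
    hence "a - b = 1" by simp
    hence "cf_value (r # qs) = 1" using \<open>1 / cf_value (r # qs) = of_int (a - b)\<close> ge(1)
      by (simp add: field_simps)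
    hence "length q = 2" using ge(2) 3 by simp
    thus ?thesis using 2(6) by simp
  qed (use 2 in auto)
next
  case (3 a r ps)
  have ge: "cf_value (r # ps) \<ge> 1" "cf_value (r # ps) = 1 \<longleftrightarrow> r # ps = [1]"
    using cf_value_ge_1[of "r # ps"] 3(4) by auto
  show ?case
  proof (cases q rule: cf_value.cases)
    case 1
    thus ?thesis using 3(3) by simp
  next
    case (2 b)
    have "1 / cf_value (r # ps) = (of_int (b - a) :: rat)" using 3(6) 2 by simp
    moreover have "1 / cf_value (r # ps) > 0" "1 / cf_value (r # ps) \<le> 1" using ge(1) by auto
    ultimately have "0 < b - a" "b - a \<le> 1"
      by (metis of_int_0_less_iff, metis of_int_le_1_iff)
    hence "b - a = 1" by simp
    hence "cf_value (r # ps) = 1" using \<open>1 / cf_value (r # ps) = of_int (b - a)\<close> ge(1)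
      by (simp add: field_simps)
    thus ?thesis using ge(2) 3(7) 2 by simp
  next
    case q: (3 b t qs)
    have ge': "cf_value (t # qs) \<ge> 1" "cf_value (t # qs) = 1 \<longleftrightarrow> t # qs = [1]"
      using cf_value_ge_1[of "t # qs"] 3(5) q by auto
    have eq: "of_int a + 1 / cf_value (r # ps) = of_int b + 1 / cf_value (t # qs)"
      using 3(6) q by simp
    have "1 / cf_value (r # ps) > 0" "1 / cf_value (r # ps) \<le> 1"
      "1 / cf_value (t # qs) > 0" "1 / cf_value (t # qs) \<le> 1" using ge(1) ge'(1) by auto
    hence "(of_int a :: rat) < of_int (b + 1)" "(of_int b :: rat) < of_int (a + 1)"
      unfolding of_int_add of_int_1 using eq by linarith+
    hence ab: "a = b" by linarith
    hence "cf_value (r # ps) = cf_value (t # qs)" using eq ge ge' by (simp add: field_simps)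
    moreover have "length (r # ps) mod 2 = length (t # qs) mod 2"
      using 3(7) q by (simp add: mod_Suc split: if_splits)
    ultimately have "r # ps = t # qs" using 3(1)[of "t # qs"] 3(4,5) q by auto
    thus ?thesis using ab q by simp
  qed
qed

lemma cf_value_append:
  "cf_value (xs @ [x + 1]) = cf_value (xs @ [x, 1])"
  by (induction xs rule: cf_value.induct) auto

lemma cf_expansion_ex1:
  assumes "x > 1" "s \<in> {0, 1}"
  shows "\<exists>!q. q \<noteq> [] \<and> (\<forall>n\<in>set q. 0 < n) \<and> cf_value q = x \<and> length q mod 2 = s"
proof -
  have ex: "\<exists>q. q \<noteq> [] \<and> (\<forall>n\<in>set q. 0 < n) \<and> cf_value q = of_int a / of_int b"
    if "0 < b" "b \<le> a" for a b :: int
    using that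
  proof (induction "nat b" arbitrary: a b rule: less_induct)
    case less
    have pos: "a div b > 0" using less.prems by (simp add: pos_imp_zdiv_pos_iff)
    show ?case
    proof (cases "a mod b = 0")
      case True
      hence "cf_value [a div b] = of_int a / of_int b"
        using less.prems(1) by (auto simp: field_simps simp flip: of_int_mult)
      thus ?thesis using pos by (intro exI[of _ "[a div b]"]) auto
    next
      case False
      hence m: "a mod b > 0" "a mod b < b" using less.prems(1)
        by (metis pos_mod_sign order_less_le, simp)
      then obtain q where q: "q \<noteq> []" "\<forall>n\<in>set q. 0 < n" "cf_value q = of_int b / of_int (a mod b)"
        using less.hyps[of "a mod b" b] by auto
      have "cf_value (a div b # q) = of_int (a div b) + of_int (a mod b) / of_int b"
        using q by (cases q) auto
      also have "\<dots> = of_int (a div b * b + a mod b) / of_int b"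
        using less.prems(1)
        unfolding of_int_add of_int_mult add_divide_distrib by simp
      finally show ?thesis using q pos by (intro exI[of _ "a div b # q"]) auto
    qed
  qed
  obtain a b where ab: "quotient_of x = (a, b)" by force
  have b: "b > 0" "x = of_int a / of_int b"
    using quotient_of_denom_pos[OF ab] quotient_of_div[OF ab] by auto
  have "of_int a / of_int b > (1 :: rat)" using assms(1) b(2) by simp
  moreover have "(of_int b :: rat) > 0" using b(1) by simp
  ultimately have "(of_int b :: rat) < of_int a" by (simp only: less_divide_eq_1_pos)
  hence "b \<le> a" by simp
  then obtain q where q: "q \<noteq> []" "\<forall>n\<in>set q. 0 < n" "cf_value q = x" using ex b by blast
  have "\<exists>q'. q' \<noteq> [] \<and> (\<forall>n\<in>set q'. 0 < n) \<and> cf_value q' = x \<and> length q' mod 2 = s"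
  proof (cases "length q mod 2 = s")
    case True
    thus ?thesis using q by blast
  next
    case False
    obtain ys y where ys: "q = ys @ [y]" using q(1) by (metis append_butlast_last_id)
    show ?thesis
    proof (cases "y = 1")
      case True
      have "ys \<noteq> []" using q(3) assms(1) ys True by auto
      then obtain zs z where zs: "ys = zs @ [z]" by (metis append_butlast_last_id)
      show ?thesis
        using q cf_value_append[of zs z] ys zs True False assms(2)
        by (intro exI[of _ "zs @ [z + 1]"]) (auto simp: mod_Suc split: if_splits)
    next
      case y: False
      hence "y > 1" using q(2) ys by force
      thus ?thesis
        using q cf_value_append[of ys "y - 1"] ys False assms(2)
        by (intro exI[of _ "ys @ [y - 1, 1]"]) (auto simp: mod_Suc split: if_splits)
    qed
  qed
  thus ?thesis using cf_value_inj by (intro ex_ex1I) (blast, metis)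
qed

fun pinch_left :: "int list \<Rightarrow> int list" where
  "pinch_left [] = []"
| "pinch_left [x] = (if x \<ge> 2 then [1, x - 1] else [x])"
| "pinch_left (x # y # zs) = (if x \<ge> 2 then 1 # (x - 1) # y # zs else (y + 1) # zs)"

definition pinch_right :: "int list \<Rightarrow> int list" where
  "pinch_right q = rev (pinch_left (rev q))"

lemma pinch_commute:
  assumes "\<forall>n\<in>set q. 0 < n"
  shows "pinch_right (pinch_left q) = pinch_left (pinch_right q)"
proof (cases q)
  case (Cons x ys)
  show ?thesis
  proof (cases ys rule: rev_cases)
    case Nil
    thus ?thesis using Cons by (auto simp: pinch_right_def)
  next
    case (snoc zs y)
    show ?thesis
    proof (cases zs)
      case Nil
      thus ?thesis using Cons snoc assms by (auto simp: pinch_right_def)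
    next
      case zs: (Cons w ws)
      show ?thesis
        using Cons snoc zs assms
        by (cases ws rule: rev_cases) (auto simp: pinch_right_def)
    qed
  qed
qed (simp add: pinch_right_def)

fun knead :: "int list \<Rightarrow> int list" where
  "knead [] = []"
| "knead (q # qs) = pinch_right (pinch_left qs) @ [q]"

definition S_set :: "int \<Rightarrow> nat \<Rightarrow> int list set" where
  "S_set a s = {q. q \<noteq> [] \<and> (\<forall>n\<in>set q. 0 < n) \<and> alternant q = a \<and> length q mod 2 = s}"

definition Z_set :: "int \<Rightarrow> nat \<Rightarrow> bqf set" where
  "Z_set a s = {f. zagier_reduced f \<and> bqf_discr f = a^2 + (-1)^s * 4}"

definition psi :: "int \<Rightarrow> nat \<Rightarrow> bqf \<Rightarrow> int list" where
  "psi a s f = (let z = of_int (a + coefB f) / 2 in cf_expansion (z / of_int (coefA f)) s)"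

text \<open>The formula for this map involves neither the alternant nor the length parity.\<close>

definition phi :: "int list \<Rightarrow> bqf" where
  "phi q = (if length q = 1 then BQF 1 (hd q) 1
            else BQF (continuant (tl q))
                     (continuant q + continuant (butlast (tl q)))
                     (continuant (butlast q)))"

end

theory Submission
  imports Defs
begin

text \<open>
  The product of the matrices \<open>((q, 1), (1, 0))\<close> over the entries of a sequence is a matrix
  \<open>((p, u), (v, w))\<close> of determinant \<open>\<plusminus>1\<close> made of continuants. The sequence has alternant \<open>p - w\<close>, its
  form is \<open>v x\<^sup>2 + (p + w) x y + u y\<^sup>2\<close>, and it is the continued fraction of \<open>p / v\<close>.
  A form together with \<open>a\<close> determines \<open>p\<close>, \<open>u\<close>, \<open>v\<close>, \<open>w\<close>, and the identity
  \<open>p (p + w - u - v) = (p - u) (p - v) + (p w - u v)\<close> turns the reducedness of the form into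
  \<open>u, v < p\<close>, which makes the matrix recoverable from \<open>p / v\<close>.
  Pinching the left or right end multiplies the matrix on that side by \<open>((1, 0), (1, -1))\<close> or its
  transpose, so kneading \<open>(q\<^sub>1, \<dots>)\<close> is the action of \<open>((n, 1), (-1, 0))\<close> with \<open>n = q\<^sub>1 + 1\<close>, apart
  from two degenerate cases. The result being reduced forces \<open>n\<close> to be the one of the Zagier step.
\<close>

section \<open>Continuant matrices\<close>

type_synonym mat2 = "int \<times> int \<times> int \<times> int"

fun mat_mul :: "mat2 \<Rightarrow> mat2 \<Rightarrow> mat2" where
  "mat_mul (a, b, c, d) (a', b', c', d') =
     (a * a' + b * c', a * b' + b * d', c * a' + d * c', c * b' + d * d')"

fun mat_transpose :: "mat2 \<Rightarrow> mat2" where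
  "mat_transpose (a, b, c, d) = (a, c, b, d)"

fun cf_mat :: "int list \<Rightarrow> mat2" where
  "cf_mat [] = (1, 0, 0, 1)"
| "cf_mat (q # qs) = mat_mul (q, 1, 1, 0) (cf_mat qs)"

lemma mat_mul_assoc: "mat_mul (mat_mul x y) z = mat_mul x (mat_mul y z)"
  by (cases x; cases y; cases z) (simp add: algebra_simps)

lemma mat_mul_one: "mat_mul (1, 0, 0, 1) x = x" "mat_mul x (1, 0, 0, 1) = x"
  by (cases x; simp)+

lemma mat_transpose_mul:
  "mat_transpose (mat_mul x y) = mat_mul (mat_transpose y) (mat_transpose x)"
  by (cases x; cases y) (simp add: algebra_simps)

lemma mat_transpose_transpose: "mat_transpose (mat_transpose x) = x"
  by (cases x) simp

lemma cf_mat_append: "cf_mat (xs @ ys) = mat_mul (cf_mat xs) (cf_mat ys)"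
  by (induction xs) (simp_all add: mat_mul_assoc mat_mul_one)

lemma cf_mat_rev: "cf_mat (rev q) = mat_transpose (cf_mat q)"
  by (induction q) (simp_all add: cf_mat_append mat_transpose_mul mat_mul_one)

lemma cf_mat_det:
  "cf_mat q = (p, u, v, w) \<Longrightarrow> p * w - u * v = (-1) ^ length q"
proof (induction q arbitrary: p u v w)
  case (Cons x q)
  obtain p' u' v' w' where m: "cf_mat q = (p', u', v', w')" by (metis prod_cases4)
  have "p * w - u * v = - (p' * w' - u' * v')"
    using Cons.prems m by (auto simp: algebra_simps)
  thus ?case using Cons.IH[OF m] by simp
qed simp

text \<open>These bounds locate the remaining entries once \<open>p\<close> and \<open>v\<close> are
  known. They are weak because of \<open>[1]\<close>, the only sequence with \<open>u = p\<close> or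
  \<open>v = p\<close>.\<close>

lemma cf_mat_bounds:
  assumes "q \<noteq> []" "\<forall>n\<in>set q. 0 < n" "cf_mat q = (p, u, v, w)"
  shows "0 < u" "u \<le> p" "0 < v" "v \<le> p" "0 \<le> w" "w \<le> v"
proof -
  have "0 < u \<and> u \<le> p \<and> 0 < v \<and> v \<le> p \<and> 0 \<le> w \<and> w \<le> v"
    using assms
  proof (induction q arbitrary: p u v w rule: cf_mat.induct)
    case (2 x q)
    show ?case
    proof (cases "q = []")
      case True
      thus ?thesis using 2 by auto
    next
      case False
      obtain p' u' v' w' where m: "cf_mat q = (p', u', v', w')" by (metis prod_cases4)
      have IH: "0 < u'" "u' \<le> p'" "0 < v'" "v' \<le> p'" "0 \<le> w'" "w' \<le> v'"
        using 2(1)[OF False _ m] 2(3) by auto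
      have e: "p = x * p' + v'" "u = x * u' + w'" "v = p'" "w = u'" using 2(4) m by auto
      have x: "1 \<le> x" using 2(3) by auto
      have "x * u' \<le> x * p'" "1 * u' \<le> x * u'" "1 * p' \<le> x * p'"
        using x IH by (intro mult_mono; simp)+
      thus ?thesis using IH e by linarith
    qed
  qed simp
  thus "0 < u" "u \<le> p" "0 < v" "v \<le> p" "0 \<le> w" "w \<le> v" by auto
qed

text \<open>The case distinction is the convention \<open>[q\<^sub>2, \<dots>, q\<^sub>l\<^sub>-\<^sub>1] = 0\<close> for \<open>l = 1\<close>.\<close>

lemma cf_mat_continuant:
  "q \<noteq> [] \<Longrightarrow> cf_mat q = (continuant q, continuant (butlast q), continuant (tl q),
     if length q = 1 then 0 else continuant (butlast (tl q)))"
proof (induction q rule: continuant.induct)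
  case (3 q r qs)
  thus ?case by (cases qs) auto
qed auto

lemma phi_cf_mat:
  assumes "q \<noteq> []" "cf_mat q = (p, u, v, w)"
  shows "phi q = BQF v (p + w) u"
proof (cases "length q = 1")
  case True
  then obtain x where "q = [x]" by (cases q) auto
  thus ?thesis using assms by (simp add: phi_def)
next
  case False
  thus ?thesis using assms cf_mat_continuant[OF assms(1)] by (simp add: phi_def)
qed

text \<open>The separate clauses for lengths one and two fit the same formula, since
  \<open>w\<close> is 0 and 1 there.\<close>

lemma alternant_cf_mat:
  assumes "q \<noteq> []" "cf_mat q = (p, u, v, w)"
  shows "alternant q = p - w"
proof (cases q rule: alternant.cases)
  case (4 x y z zs)
  thus ?thesis using assms cf_mat_continuant[OF assms(1)] by simp
qed (use assms in auto)

lemma cf_value_cf_mat: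
  assumes "q \<noteq> []" "\<forall>n\<in>set q. 0 < n" "cf_mat q = (p, u, v, w)"
  shows "cf_value q = of_int p / of_int v"
  using assms
proof (induction q arbitrary: p u v w rule: cf_value.induct)
  case (3 x y ys)
  obtain p' u' v' w' where m: "cf_mat (y # ys) = (p', u', v', w')" by (metis prod_cases4)
  have IH: "cf_value (y # ys) = of_int p' / of_int v'" using 3(1)[OF _ _ m] 3(3) by simp
  have pos: "0 < v'" "v' \<le> p'" using cf_mat_bounds[OF _ _ m] 3(3) by auto
  have e: "p = x * p' + v'" "v = p'" using 3(4) m by auto
  have "of_int x + 1 / (of_int p' / of_int v') = of_int (x * p' + v') / (of_int p' :: rat)"
    using pos by (simp add: field_simps)
  thus ?case using IH e by simp
qed auto

section \<open>The bijection\<close>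

lemma S_set_data:
  assumes "q \<in> S_set a s" "cf_mat q = (p, u, v, w)"
  shows "q \<noteq> []" "\<forall>n\<in>set q. 0 < n" "p - w = a" "p * w - u * v = (-1) ^ s"
    "0 < u" "u \<le> p" "0 < v" "v \<le> p"
proof -
  show q: "q \<noteq> []" "\<forall>n\<in>set q. 0 < n" using assms by (auto simp: S_set_def)
  show "p - w = a" using alternant_cf_mat[OF q(1) assms(2)] assms(1) by (simp add: S_set_def)
  have "length q mod 2 = s" using assms(1) by (simp add: S_set_def)
  hence "(-1 :: int) ^ length q = (-1) ^ s" by (auto simp: minus_one_power_iff)
  thus "p * w - u * v = (-1) ^ s" using cf_mat_det[OF assms(2)] by simp
  show "0 < u" "u \<le> p" "0 < v" "v \<le> p" using cf_mat_bounds[OF q assms(2)] by simp_all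
qed

text \<open>The excluded pairs arise from \<open>key\<close>: for \<open>s = 1\<close> positivity
  needs \<open>(p - u) * (p - v) > 1\<close>, and the values 0 and 1 of this product force
  \<open>a = 1\<close> and \<open>a = 2\<close>.\<close>

lemma phi_in_Z_set:
  assumes "s \<in> {0, 1}" "(a, s) \<noteq> (1, 1)" "(a, s) \<noteq> (2, 1)" "q \<in> S_set a s"
  shows "phi q \<in> Z_set a s"
proof -
  obtain p u v w where m: "cf_mat q = (p, u, v, w)" by (metis prod_cases4)
  note d = S_set_data[OF assms(4) m]
  have key: "p * (p + w - u - v) = (p - u) * (p - v) + (-1) ^ s"
    using d(4) by (simp add: algebra_simps)
  have "0 < p * (p + w - u - v)"
  proof (cases "s = 0")
    case True
    have "0 \<le> (p - u) * (p - v)" using d by simp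
    thus ?thesis using key True by simp
  next
    case False
    hence s: "s = 1" using assms(1) by simp
    show ?thesis
    proof (cases "u = p \<or> v = p")
      case True
      hence "p * (u + v - p - w) = 1" using key s by (auto simp: algebra_simps)
      hence "p = 1" using d by (simp add: pos_zmult_eq_1_iff)
      hence "u = 1" "v = 1" using d by auto
      hence "a = 1" using d(3,4) s \<open>p = 1\<close> by simp
      thus ?thesis using assms(2) s by simp
    next
      case False
      hence lt: "1 \<le> p - u" "1 \<le> p - v" using d by auto
      show ?thesis
      proof (cases "p - u = 1 \<and> p - v = 1")
        case True
        hence "p * (p + w - u - v) = 0" using key s by simp
        hence "a = 2" using True d by auto
        thus ?thesis using assms(3) s by simp
      next
        case False
        hence "1 < p - u \<or> 1 < p - v" using lt by auto
        hence "1 < (p - u) * (p - v)" using lt by (smt (verit) mult_le_cancel_right1 mult_le_cancel_left1)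
        thus ?thesis using key s by simp
      qed
    qed
  qed
  hence "u + v < p + w" using d by (simp add: zero_less_mult_iff)
  \<comment> \<open>Since \<open>(p + w)^2 = (p - w)^2 + 4 * p * w\<close>, the discriminant is the
    squared alternant plus four times the determinant.\<close>
  moreover have "(p + w)^2 - 4 * v * u = a^2 + (-1)^s * 4"
    unfolding d(3,4)[symmetric] by (simp add: power2_eq_square algebra_simps)
  ultimately show ?thesis
    using d by (simp add: Z_set_def zagier_reduced_def bqf_discr_def phi_cf_mat[OF d(1) m])
qed

text \<open>The entries solve \<open>p + w = B\<close> and \<open>p - w = a\<close>. The
  discriminant makes \<open>a\<close> and \<open>B\<close> of equal parity, so the solution is
  integral, and it also gives the determinant.\<close>

lemma Z_set_data:
  assumes "0 < a" "s \<in> {0, 1}" "f \<in> Z_set a s"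
  obtains p u v w where "f = BQF v (p + w) u" "p - w = a" "p * w - u * v = (-1) ^ s"
    "0 < u" "u < p" "0 < v" "v < p"
proof -
  obtain A B C where f: "f = BQF A B C" by (cases f)
  have red: "0 < A" "0 < C" "A + C < B" and D: "B^2 - 4 * A * C = a^2 + (-1)^s * 4"
    using assms(3) by (auto simp: Z_set_def zagier_reduced_def bqf_discr_def f)
  have "B^2 - a^2 = 2 * (2 * A * C + (-1)^s * 2)" using D by simp
  hence "even (B^2 - a^2)" by simp
  hence "even (B - a)" by simp
  then obtain w where w: "B - a = 2 * w" by blast
  define p where "p = w + a"
  have B: "B = p + w" and pw: "p - w = a" using w by (simp_all add: p_def)
  have "4 * (p * w - C * A) = 4 * (-1)^s"
    using D unfolding B pw[symmetric] by (simp add: power2_eq_square algebra_simps)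
  hence det: "p * w - C * A = (-1)^s" by simp
  \<comment> \<open>Here \<open>2 * p = a + B\<close> and \<open>B\<close> is at least 3. The bound
    keeps the product in \<open>key\<close> positive after \<open>(-1)^s\<close> is
    subtracted.\<close>
  have p: "2 \<le> p" using red B pw assms(1) by linarith
  have key: "(p - C) * (p - A) = p * (B - C - A) - (-1)^s"
    using det unfolding B by (simp add: algebra_simps)
  have "p * 1 \<le> p * (B - C - A)" using p red by (intro mult_left_mono) auto
  hence "0 < (p - C) * (p - A)" using key p assms(2) by (smt (verit) insertE power_0 power_one_right singletonD)
  hence "C < p \<and> A < p \<or> p < C \<and> p < A" by (simp add: zero_less_mult_iff)
  \<comment> \<open>If \<open>p\<close> were below both, then
    \<open>2 * p < A + C < B = 2 * p - a\<close>, against \<open>0 < a\<close>.\<close>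
  hence "C < p" "A < p" using red B pw assms(1) by linarith+
  thus ?thesis using that[of A p w C] f B pw det red by simp
qed

lemma coprime_fraction_eq:
  assumes "coprime p v" "coprime p' v'" "0 < p" "0 < v" "0 < p'" "0 < v'"
    "of_int p / of_int v = (of_int p' / of_int v' :: rat)"
  shows "p = p'" "v = v'"
proof -
  have "(of_int (p * v') :: rat) = of_int (p' * v)" using assms by (simp add: field_simps)
  hence "p * v' = p' * v" by (simp only: of_int_eq_iff)
  hence "\<bar>p\<bar> * \<bar>v'\<bar> = \<bar>p'\<bar> * \<bar>v\<bar>" using assms by simp
  hence "p = p' \<and> v = v'"
    using coprime_crossproduct_int[of p v p' v'] assms by simp
  thus "p = p'" "v = v'" by auto
qed

lemma coprime_of_det:
  fixes p w u v :: int
  assumes "p * w - u * v = (-1) ^ s"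
  shows "coprime p v"
proof (rule coprimeI)
  fix c assume "c dvd p" "c dvd v"
  hence "c dvd (-1) ^ s" unfolding assms[symmetric] by simp
  thus "c dvd 1" by (metis dvd_trans dvd_refl minus_one_power_iff minus_dvd_iff dvd_minus_iff)
qed

lemma cf_expansion_eqI:
  assumes "q \<noteq> []" "\<forall>n\<in>set q. 0 < n" "cf_value q = x" "length q mod 2 = s"
  shows "cf_expansion x s = q"
  unfolding cf_expansion_def using assms cf_value_inj
  by (intro the_equality) (blast, metis)

lemma psi_phi:
  assumes "q \<in> S_set a s"
  shows "psi a s (phi q) = q"
proof -
  obtain p u v w where m: "cf_mat q = (p, u, v, w)" by (metis prod_cases4)
  note d = S_set_data[OF assms m]
  \<comment> \<open>So the number \<open>z\<close> in \<open>psi\<close> is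
    \<open>p\<close>.\<close>
  have "a + (p + w) = 2 * p" using d(3) by simp
  hence "of_int (a + (p + w)) / 2 = (of_int p :: rat)" 
    by (metis of_int_mult of_int_numeral nonzero_mult_div_cancel_left zero_neq_numeral)
  hence "psi a s (phi q) = cf_expansion (of_int p / of_int v) s"
    by (simp add: psi_def phi_cf_mat[OF d(1) m] del: of_int_add)
  thus ?thesis
    using cf_expansion_eqI[OF d(1,2) cf_value_cf_mat[OF d(1,2) m]] assms
    by (simp add: S_set_def)
qed

text \<open>The first column of the expansion's matrix is the reduced fraction \<open>p / v\<close>.
  The prescribed length parity fixes its determinant, which determines \<open>u\<close> modulo
  \<open>p\<close> and hence the second column.\<close>

lemma psi_Z_set:
  assumes "0 < a" "s \<in> {0, 1}" "f \<in> Z_set a s"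
  shows "psi a s f \<in> S_set a s" "phi (psi a s f) = f"
proof -
  obtain p u v w where f: "f = BQF v (p + w) u" and pw: "p - w = a"
    and det: "p * w - u * v = (-1) ^ s" and b: "0 < u" "u < p" "0 < v" "v < p"
    using Z_set_data[OF assms] by metis
  have "a + (p + w) = 2 * p" using pw by simp
  hence "of_int (a + (p + w)) / 2 = (of_int p :: rat)" 
    by (metis of_int_mult of_int_numeral nonzero_mult_div_cancel_left zero_neq_numeral)
  hence psi: "psi a s f = cf_expansion (of_int p / of_int v) s" by (simp add: psi_def f del: of_int_add)
  \<comment> \<open>Strictness matters: the value 1 has only the expansion \<open>[1]\<close>, so
    only one parity.\<close>
  have "(of_int p / of_int v :: rat) > 1" using b by simp
  from theI'[OF cf_expansion_ex1[OF this assms(2)]]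
  have q: "psi a s f \<noteq> []" "\<forall>n\<in>set (psi a s f). 0 < n"
    "cf_value (psi a s f) = of_int p / of_int v" "length (psi a s f) mod 2 = s"
    unfolding psi cf_expansion_def by blast+
  obtain p' u' v' w' where m: "cf_mat (psi a s f) = (p', u', v', w')" by (metis prod_cases4)
  note bd = cf_mat_bounds[OF q(1,2) m]
  have det': "p' * w' - u' * v' = (-1) ^ s"
    using cf_mat_det[OF m] q(4) by (metis even_mod_2_iff minus_one_power_iff)
  have eq: "p' = p" "v' = v"
    using coprime_fraction_eq[of p' v' p v] coprime_of_det[OF det] coprime_of_det[OF det'] bd b
      cf_value_cf_mat[OF q(1,2) m] q(3) by auto
  have e: "p * (w' - w) = v * (u' - u)" using det det' eq by (simp add: algebra_simps)
  hence "p dvd v * (u' - u)" by (metis dvd_triv_left)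
  hence "p dvd u' - u" using coprime_of_det[OF det] by (simp add: coprime_dvd_mult_right_iff)
  \<comment> \<open>Both \<open>u\<close> and \<open>u'\<close> lie between 1 and \<open>p\<close>,
    so they differ by less than \<open>p\<close>.\<close>
  hence "u' - u = 0" using dvd_imp_le_int[of "u' - u" p] b bd eq by linarith
  hence uw: "u' = u" "w' = w" using e b by auto
  show "psi a s f \<in> S_set a s"
    using q alternant_cf_mat[OF q(1) m] eq uw pw by (simp add: S_set_def)
  show "phi (psi a s f) = f" using phi_cf_mat[OF q(1) m] f eq uw by simp
qed

section \<open>Zagier reduction and kneading\<close>

text \<open>Let \<open>P(x) = A * x^2 - B * x + C\<close>, whose larger root is
  \<open>\<theta>\<close>. The new form being reduced says \<open>P(n) > 0\<close> and
  \<open>P(n - 1) < 0\<close>, which places \<open>\<theta>\<close> strictly between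
  \<open>n - 1\<close> and \<open>n\<close>.\<close>

lemma zagier_step_eqI:
  assumes "zagier_reduced f" "zagier_reduced (bqf_act n 1 (-1) 0 f)"
  shows "zagier_step f = bqf_act n 1 (-1) 0 f"
proof -
  obtain A B C where f: "f = BQF A B C" by (cases f)
  define D where "D = B^2 - 4 * A * C"
  define \<theta> :: real where "\<theta> = (of_int B + sqrt (of_int D)) / (2 * of_int A)"
  have red: "0 < A" "0 < C" "A + C < B" using assms(1) by (auto simp: zagier_reduced_def f)
  have red': "0 < A * n^2 - B * n + C" "A * n^2 - B * n + C + A < 2 * A * n - B"
    using assms(2) by (auto simp: zagier_reduced_def bqf_act_def f)
  have sq: "(2 * A * x - B)^2 - D = 4 * A * (A * x^2 - B * x + C)" for x
    by (simp add: D_def power2_eq_square algebra_simps)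
  have "0 < (2 * A * n - B)^2 - D" unfolding sq using red red' by simp
  hence 1: "D < (2 * A * n - B)^2" by simp
  have "A * (n - 1)^2 - B * (n - 1) + C < 0"
    using red'(2) by (simp add: power2_eq_square algebra_simps)
  hence "(2 * A * (n - 1) - B)^2 - D < 0" unfolding sq using red by (simp add: mult_pos_neg)
  hence 2: "(2 * A * (n - 1) - B)^2 < D" by simp
  have "sqrt (of_int D) < of_int (2 * A * n - B)"
  proof (rule real_less_lsqrt)
    \<comment> \<open>This sign puts \<open>n\<close> to the right of the larger root, not to the
      left of the smaller one.\<close>
    show "0 \<le> (of_int (2 * A * n - B) :: real)" using red red' by (simp only: of_int_0_le_iff)
    show "of_int D < (of_int (2 * A * n - B) :: real)^2"
      using 1 by (simp only: of_int_less_iff of_int_power[symmetric])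
  qed
  hence up: "\<theta> < of_int n" using red by (simp add: \<theta>_def field_simps)
  have "of_int (2 * A * (n - 1) - B) < sqrt (of_int D)"
  proof (rule real_less_rsqrt)
    show "(of_int (2 * A * (n - 1) - B) :: real)^2 < of_int D"
      using 2 by (simp only: of_int_less_iff of_int_power[symmetric])
  qed
  hence lo: "of_int n - 1 < \<theta>" using red by (simp add: \<theta>_def field_simps)
  have "(THE n::int. of_int n - 1 < \<theta> \<and> \<theta> < of_int n) = n"
    using up lo by (intro the_equality) auto
  thus ?thesis by (simp add: zagier_step_def \<theta>_def D_def bqf_discr_def f Let_def)
qed

text \<open>The factor is an involution of determinant -1: the two cases of pinching undo each other
  and flip the length parity. The result is again not \<open>[1]\<close>, so the other end can be
  pinched next.\<close>

lemma pinch_left_props: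
  assumes "q \<noteq> []" "q \<noteq> [1]" "\<forall>n\<in>set q. 0 < n"
  shows "cf_mat (pinch_left q) = mat_mul (1, 0, 1, -1) (cf_mat q)"
    "pinch_left q \<noteq> []" "pinch_left q \<noteq> [1]" "\<forall>n\<in>set (pinch_left q). 0 < n"
    "even (length (pinch_left q)) \<longleftrightarrow> odd (length q)"
proof -
  have "cf_mat (pinch_left q) = mat_mul (1, 0, 1, -1) (cf_mat q) \<and>
    pinch_left q \<noteq> [] \<and> pinch_left q \<noteq> [1] \<and> (\<forall>n\<in>set (pinch_left q). 0 < n) \<and>
    (even (length (pinch_left q)) \<longleftrightarrow> odd (length q))"
  proof (cases q rule: pinch_left.cases)
    case (3 x y zs)
    obtain p u v w where m: "cf_mat zs = (p, u, v, w)" by (metis prod_cases4)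
    show ?thesis using assms 3 m by (cases "x = 1") (auto simp: algebra_simps)
  qed (use assms in auto)
  thus "cf_mat (pinch_left q) = mat_mul (1, 0, 1, -1) (cf_mat q)"
    "pinch_left q \<noteq> []" "pinch_left q \<noteq> [1]" "\<forall>n\<in>set (pinch_left q). 0 < n"
    "even (length (pinch_left q)) \<longleftrightarrow> odd (length q)" by blast+
qed

lemma pinch_right_props:
  assumes "q \<noteq> []" "q \<noteq> [1]" "\<forall>n\<in>set q. 0 < n"
  shows "cf_mat (pinch_right q) = mat_mul (cf_mat q) (1, 1, 0, -1)"
    "pinch_right q \<noteq> []" "\<forall>n\<in>set (pinch_right q). 0 < n"
    "even (length (pinch_right q)) \<longleftrightarrow> odd (length q)"
proof -
  have r: "rev q \<noteq> []" "rev q \<noteq> [1]" "\<forall>n\<in>set (rev q). 0 < n" using assms by auto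
  note L = pinch_left_props[OF r]
  show "cf_mat (pinch_right q) = mat_mul (cf_mat q) (1, 1, 0, -1)"
    by (simp add: pinch_right_def cf_mat_rev L(1) mat_transpose_mul mat_transpose_transpose)
  show "pinch_right q \<noteq> []" "\<forall>n\<in>set (pinch_right q). 0 < n"
    "even (length (pinch_right q)) \<longleftrightarrow> odd (length q)"
    using L by (simp_all add: pinch_right_def)
qed

text \<open>Pinching fixes the tails \<open>[]\<close> and \<open>[1]\<close>, so these are computed
  directly, with \<open>n\<close> equal to \<open>x\<close> and \<open>x + 2\<close>; otherwise
  \<open>n = x + 1\<close>.\<close>

lemma knead_S_set:
  assumes "q \<in> S_set a s"
  shows "knead q \<in> S_set a s \<and> (\<exists>n. phi (knead q) = bqf_act n 1 (-1) 0 (phi q))"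
proof -
  have q: "q \<noteq> []" "\<forall>n\<in>set q. 0 < n" "alternant q = a" "length q mod 2 = s"
    using assms by (auto simp: S_set_def)
  obtain x r where x: "q = x # r" using q(1) by (cases q) auto
  consider "r = []" | "r = [1]" | "r \<noteq> []" "r \<noteq> [1]" by blast
  thus ?thesis
  proof cases
    case 1
    have "phi q = bqf_act x 1 (-1) 0 (phi q)"
      by (simp add: x 1 phi_def bqf_act_def power2_eq_square)
    thus ?thesis using assms by (auto simp: x 1 pinch_right_def)
  next
    case 2
    have "phi [1, x] = bqf_act (x + 2) 1 (-1) 0 (phi q)"
      by (simp add: x 2 phi_def bqf_act_def power2_eq_square algebra_simps)
    thus ?thesis using assms by (auto simp: x 2 pinch_right_def S_set_def)
  next
    case 3
    have pos: "\<forall>n\<in>set r. 0 < n" using q(2) x by simp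
    note L = pinch_left_props[OF 3 pos]
    note R = pinch_right_props[OF L(2,3,4)]
    obtain v w g h where m: "cf_mat r = (v, w, g, h)" by (metis prod_cases4)
    have mq: "cf_mat q = (x * v + g, x * w + h, v, w)" using m by (simp add: x)
    have mk: "cf_mat (knead q) =
      (v * x + (v - w), v, (v - g) * x + (v - g - w + h), v - g)"
      using m by (simp add: x cf_mat_append R(1) L(1) algebra_simps)
    have k: "knead q \<noteq> []" "\<forall>n\<in>set (knead q). 0 < n" using R q(2) by (auto simp: x)
    \<comment> \<open>Each of the two pinches flips the parity, and moving \<open>x\<close> to the
      end preserves the length.\<close>
    have "even (length (knead q)) \<longleftrightarrow> even (length q)" using L(5) R(4) by (simp add: x)
    hence "length (knead q) mod 2 = s" using q(4) by (simp add: mod_2_eq_odd)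
    moreover have "alternant (knead q) = alternant q"
      using alternant_cf_mat[OF k(1) mk] alternant_cf_mat[OF q(1) mq] by (simp add: algebra_simps)
    ultimately have "knead q \<in> S_set a s" using k q(3) by (simp add: S_set_def)
    moreover have "phi (knead q) = bqf_act (x + 1) 1 (-1) 0 (phi q)"
      by (simp add: phi_cf_mat[OF k(1) mk] phi_cf_mat[OF q(1) mq] bqf_act_def
          power2_eq_square algebra_simps)
    ultimately show ?thesis by blast
  qed
qed

theorem theorem1:
  fixes a :: int and s :: nat
  assumes "a > 0" and "s \<in> {0, 1}" and "(a, s) \<noteq> (1, 1)" and "(a, s) \<noteq> (2, 1)"
  shows "((\<forall>q \<in> S_set a s. phi q \<in> Z_set a s) \<and>
          (\<forall>f \<in> Z_set a s. psi a s f \<in> S_set a s) \<and>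
          (\<forall>q \<in> S_set a s. psi a s (phi q) = q) \<and>
          (\<forall>f \<in> Z_set a s. phi (psi a s f) = f) \<and>
          bij_betw phi (S_set a s) (Z_set a s) \<and>
          bij_betw (psi a s) (Z_set a s) (S_set a s)) \<and>
         (\<forall>f \<in> Z_set a s. zagier_step f \<in> Z_set a s \<and>
            psi a s (zagier_step f) = knead (psi a s f))"
proof -
  note phi_Z = phi_in_Z_set[OF assms(2-4)] and psi_S = psi_Z_set[OF assms(1,2)]
  have "bij_betw phi (S_set a s) (Z_set a s)"
    by (rule bij_betw_byWitness[where f' = "psi a s"]) (use phi_Z psi_S psi_phi in auto)
  moreover have "bij_betw (psi a s) (Z_set a s) (S_set a s)"
    by (rule bij_betw_byWitness[where f' = phi]) (use phi_Z psi_S psi_phi in auto)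
  moreover have "zagier_step f \<in> Z_set a s \<and> psi a s (zagier_step f) = knead (psi a s f)"
    if f: "f \<in> Z_set a s" for f
  proof -
    obtain n where k: "knead (psi a s f) \<in> S_set a s"
      and n: "phi (knead (psi a s f)) = bqf_act n 1 (-1) 0 f"
      using knead_S_set[OF psi_S(1)[OF f]] psi_S(2)[OF f] by auto
    \<comment> \<open>Both forms are reduced, the second because the kneaded sequence stays in
      \<open>S_set a s\<close>; this identifies \<open>n\<close> as that of the reduction
      step.\<close>
    have "zagier_step f = phi (knead (psi a s f))"
      using zagier_step_eqI[of f n] phi_Z[OF k] f by (simp add: n Z_set_def)
    thus ?thesis using phi_Z[OF k] psi_phi[OF k] by simp
  qed
  ultimately show ?thesis using phi_Z psi_S psi_phi by blast
qed

end
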